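(* Let $G\in\mathcal G$ be a graph with a walk $u-x_1-x_2-v$, where $u,v\in V(G)$ (possibly $u=v$) and $x_1,x_2\in V(G)\setminus\{u,v\}$ are distinct vertices of degree $2$ in $G$. Let $G'$ be the graph obtained from $G$ by removing the vertices $x_1$ and $x_2$ and adding an edge between $u$ and $v$ (a loop at $u$ if $u=v$). Then $\operatorname{gap}(G)\le\operatorname{gap}(G')$. Furthermore, if $G'\in\mathcal G$, then $\operatorname{gap}(G)=\operatorname{gap}(G')$.
   Context: Graphs are finite and undirected, without multiple edges, possibly with loops $\{u,u\}$. $N_G[v]=\{w:\{v,w\}\in E(G)\}$; $\deg_G(v)=|N_G[v]|$ if $v$ has no loop and $|N_G[v]|+1$ if $v$ has a loop. $\mathcal G$ is the family of graphs $G$ with no vertices $u_1,u_2,v_1,v_2\in V(G)$, $u_1\neq u_2$, $v_1\ne v_2$, such that $\{u_i,v_j\}\in E(G)$ for all $i,j\in\{1,2\}$ (the $u$'s may coincide with the $v$'s). For nonempty $\mathcal K,\mathcal L\subseteq V(G)$ (possibly intersecting), the set-join $\mathcal K\vee\mathcal L$ is the graph on $V(G)$ with edges $\{i,j\}$, $i\in\mathcal K$, $j\in\mathcal L$. A set-join cover of $G$ is $\mathscr C=\{\mathcal K_i\vee\mathcal L_i: i\in[t]\}$ with $E(G)=\bigcup_i E(\mathcal K_i\vee\mathcal L_i)$; its component set is $V(\mathscr C)=\{\mathcal K_i\}_i\cup\{\mathcal L_i\}_i$. The SNT-rank is $\mathrm{st}_+(G)=\min|V(\mathscr C)|$ over all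 set-join covers of $G$ (the empty cover is used for an edgeless graph), and $\operatorname{gap}(G)=|V(G)|-\mathrm{st}_+(G)$; the graph with no vertices has gap $0$. *)

theory Defs
  imports Main
begin

text \<open>Finite undirected graphs without multiple edges, possibly with loops. An edge between
  \<open>u\<close> and \<open>v\<close> is the set \<open>{u, v}\<close>; a loop at \<open>u\<close> is \<open>{u, u} = {u}\<close>.\<close>

record 'a lgraph =
  verts :: "'a set"
  edges :: "'a set set"

definition graph :: "'a lgraph \<Rightarrow> bool" where
  "graph G \<longleftrightarrow> finite (verts G) \<and>
     (\<forall>e \<in> edges G. \<exists>u \<in> verts G. \<exists>v \<in> verts G. e = {u, v})"

definition nbhd :: "'a lgraph \<Rightarrow> 'a \<Rightarrow> 'a set" where
  "nbhd G v = {w. {v, w} \<in> edges G}"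

text \<open>A vertex with a loop belongs to its own neighbourhood, so a loop contributes 2 in total.\<close>

definition deg :: "'a lgraph \<Rightarrow> 'a \<Rightarrow> nat" where
  "deg G v = (if {v, v} \<in> edges G then card (nbhd G v) + 1 else card (nbhd G v))"

definition walk :: "'a lgraph \<Rightarrow> 'a list \<Rightarrow> bool" where
  "walk G xs \<longleftrightarrow> xs \<noteq> [] \<and> set xs \<subseteq> verts G \<and>
     successively (\<lambda>a b. {a, b} \<in> edges G) xs"

text \<open>The family of graphs written as a calligraphic G; \<open>u1, u2\<close> may coincide with \<open>v1, v2\<close>.\<close>

definition calG :: "'a lgraph set" where
  "calG = {G. graph G \<and>
     \<not> (\<exists>u1 \<in> verts G. \<exists>u2 \<in> verts G. \<exists>v1 \<in> verts G. \<exists>v2 \<in> verts G.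
          u1 \<noteq> u2 \<and> v1 \<noteq> v2 \<and>
          {u1, v1} \<in> edges G \<and> {u1, v2} \<in> edges G \<and>
          {u2, v1} \<in> edges G \<and> {u2, v2} \<in> edges G)}"

definition set_join :: "'a set \<Rightarrow> 'a set \<Rightarrow> 'a set \<Rightarrow> 'a lgraph" where
  "set_join V K L = \<lparr>verts = V, edges = {{i, j} | i j. i \<in> K \<and> j \<in> L}\<rparr>"

text \<open>A cover is given by its set of pairs \<open>(K, L)\<close>, since the component set refers to
  \<open>K\<close> and \<open>L\<close> and not only to the graph \<open>set_join (verts G) K L\<close>. For a graph \<open>G\<close> any such set is
  automatically finite.\<close>

definition set_join_cover :: "'a lgraph \<Rightarrow> ('a set \<times> 'a set) set \<Rightarrow> bool" where
  "set_join_cover G C \<longleftrightarrow>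
     (\<forall>(K, L) \<in> C. K \<noteq> {} \<and> L \<noteq> {} \<and> K \<subseteq> verts G \<and> L \<subseteq> verts G) \<and>
     edges G = (\<Union>(K, L) \<in> C. edges (set_join (verts G) K L))"

definition components :: "('a set \<times> 'a set) set \<Rightarrow> 'a set set" where
  "components C = fst ` C \<union> snd ` C"

definition st_plus :: "'a lgraph \<Rightarrow> nat" where
  "st_plus G = (LEAST k. \<exists>C. set_join_cover G C \<and> card (components C) = k)"

definition gap :: "'a lgraph \<Rightarrow> int" where
  "gap G = int (card (verts G)) - int (st_plus G)"

definition remove_verts :: "'a lgraph \<Rightarrow> 'a set \<Rightarrow> 'a lgraph" where
  "remove_verts G X = \<lparr>verts = verts G - X, edges = {e \<in> edges G. e \<inter> X = {}}\<rparr>"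

definition add_edge :: "'a lgraph \<Rightarrow> 'a \<Rightarrow> 'a \<Rightarrow> 'a lgraph" where
  "add_edge G u v = \<lparr>verts = verts G, edges = insert {u, v} (edges G)\<rparr>"

text \<open>Every graph has a set-join cover, so the minimum in \<open>st_plus\<close> is attained.\<close>

lemma set_join_cover_exists:
  assumes "graph G"
  shows "\<exists>C. set_join_cover G C"
proof -
  let ?C = "{({u}, {v}) | u v. u \<in> verts G \<and> v \<in> verts G \<and> {u, v} \<in> edges G}"
  have "edges G = (\<Union>(K, L) \<in> ?C. edges (set_join (verts G) K L))"
  proof (intro subset_antisym subsetI)
    fix e assume e: "e \<in> edges G"
    then obtain u v where uv: "u \<in> verts G" "v \<in> verts G" "e = {u, v}"
      using assms unfolding graph_def by blast
    then have "({u}, {v}) \<in> ?C" using e by blast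
    then show "e \<in> (\<Union>(K, L) \<in> ?C. edges (set_join (verts G) K L))"
      by (rule UN_I) (simp add: set_join_def uv)
  qed (auto simp: set_join_def)
  then have "set_join_cover G ?C"
    unfolding set_join_cover_def by auto
  then show ?thesis ..
qed

lemma st_plus_attained:
  assumes "graph G"
  shows "\<exists>C. set_join_cover G C \<and> card (components C) = st_plus G"
  unfolding st_plus_def
  by (rule LeastI_ex[where P = "\<lambda>k. \<exists>C. set_join_cover G C \<and> card (components C) = k"])
    (use set_join_cover_exists[OF assms] in blast)

end

theory Submission
  imports Defs
begin

text \<open>
  In a graph of the family a common neighbour of two vertices is unique, so every set-join of a
  cover is a star, and a component with at least two elements has only one partner. Both
  \<open>st\<^sub>+(G) \<ge> st\<^sub>+(G') + 2\<close> and the converse inequality come from rewriting covers. Downwards,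
  deleting \<open>x1, x2\<close> from all components (and joining \<open>{u}\<close> to \<open>{v}\<close>) loses two components, unless
  the cover uses \<open>{x1} \<or> {u, x2}\<close> without having \<open>{u}\<close> or \<open>{x2}\<close> as components, or the mirror
  image of this; then \<open>{x1}\<close> and \<open>{u, x2}\<close> are dropped and \<open>x2\<close> is replaced by \<open>u\<close>. Upwards,
  \<open>u\<close> is replaced by \<open>x2\<close> in the stars centred at \<open>v\<close> (and \<open>v\<close> by \<open>x1\<close> in those centred at \<open>u\<close>),
  and two components are added: \<open>{x1}, {x2}\<close> if \<open>{u}\<close> and \<open>{v}\<close> are components, otherwise
  \<open>{x1}, {u, x2}\<close> or its mirror image.
\<close>

section \<open>Covers as symmetric relations on vertex sets\<close>

text \<open>Closing the pairs under exchange turns the component set into \<open>Domain C\<close>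
  and lets an edge be read with its endpoints in either order. By symmetry every argument about the
  first side of a pair also serves the second.\<close>

definition sym_cover :: "'a lgraph \<Rightarrow> ('a set \<times> 'a set) set \<Rightarrow> bool" where
  "sym_cover G C \<longleftrightarrow> sym C \<and> finite (Domain C) \<and>
     (\<forall>K L. (K, L) \<in> C \<longrightarrow> K \<noteq> {} \<and> L \<noteq> {} \<and> (\<forall>a \<in> K. \<forall>b \<in> L. {a, b} \<in> edges G)) \<and>
     (\<forall>a b. {a, b} \<in> edges G \<longrightarrow> (\<exists>K L. (K, L) \<in> C \<and> a \<in> K \<and> b \<in> L))"

lemma sym_coverD:
  assumes "sym_cover G C"
  shows "(K, L) \<in> C \<Longrightarrow> (L, K) \<in> C"
    and "finite (Domain C)"
    and "(K, L) \<in> C \<Longrightarrow> K \<noteq> {}"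
    and "(K, L) \<in> C \<Longrightarrow> a \<in> K \<Longrightarrow> b \<in> L \<Longrightarrow> {a, b} \<in> edges G"
    and "{a, b} \<in> edges G \<Longrightarrow> \<exists>K L. (K, L) \<in> C \<and> a \<in> K \<and> b \<in> L"
  using assms unfolding sym_cover_def by (auto dest: symD)

lemma graph_edgeD:
  assumes "graph G" "{a, b} \<in> edges G"
  shows "a \<in> verts G" "b \<in> verts G"
  using assms unfolding graph_def by (metis doubleton_eq_iff)+

text \<open>Adding the reversed pairs to an optimal cover changes neither the edges covered nor the
  set of components.\<close>

lemma sym_cover_attained:
  assumes "graph G"
  obtains C where "sym_cover G C" "card (Domain C) = st_plus G"
proof -
  obtain C where C: "set_join_cover G C" and card: "card (components C) = st_plus G"
    using st_plus_attained[OF assms] by blast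
  have pairs: "K \<noteq> {} \<and> L \<noteq> {} \<and> K \<subseteq> verts G \<and> L \<subseteq> verts G" if "(K, L) \<in> C" for K L
    using C that unfolding set_join_cover_def by blast
  have edges: "edges G = (\<Union>(K, L) \<in> C. {{i, j} | i j. i \<in> K \<and> j \<in> L})"
    using C unfolding set_join_cover_def set_join_def by simp
  let ?D = "C \<union> C\<inverse>"
  have dom: "Domain ?D = components C"
    unfolding components_def by force
  have "components C \<subseteq> Pow (verts G)"
    using pairs unfolding components_def by force
  then have fin: "finite (components C)"
    using assms finite_subset unfolding graph_def by blast
  have join: "{a, b} \<in> edges G" if "(K, L) \<in> C" "a \<in> K" "b \<in> L" for K L a b
    using that edges by blast
  have joins: "\<forall>a \<in> K. \<forall>b \<in> L. {a, b} \<in> edges G" if "(K, L) \<in> ?D" for K L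
    using that join by (metis UnE converseD insert_commute)
  have covered: "\<exists>K L. (K, L) \<in> ?D \<and> a \<in> K \<and> b \<in> L" if e: "{a, b} \<in> edges G" for a b
  proof -
    obtain p where "p \<in> C" "{a, b} \<in> (case p of (K, L) \<Rightarrow> {{i, j} | i j. i \<in> K \<and> j \<in> L})"
      using e unfolding edges by (rule UN_E)
    then obtain K L i j where KL: "(K, L) \<in> C" "{a, b} = {i, j}" "i \<in> K" "j \<in> L"
      by (cases p) auto
    then have "(K, L) \<in> ?D" "(L, K) \<in> ?D" by blast+
    then show ?thesis using KL by (metis doubleton_eq_iff)
  qed
  have nonempty: "K \<noteq> {}" "L \<noteq> {}" if "(K, L) \<in> ?D" for K L
    using that pairs by blast+
  have "sym_cover G ?D"
    unfolding sym_cover_def dom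
    by (intro conjI allI impI sym_Un_converse fin joins covered nonempty)
  then show ?thesis
    by (rule that) (simp only: dom card)
qed

text \<open>Tailored to images of covers: a map that deletes vertices may empty a component, so
  pairs with an empty side are tolerated and discarded here, and \<open>S\<close> has to hold only
  the components of the remaining pairs.\<close>

lemma st_plus_le_card:
  assumes G: "graph G" and S: "finite S"
    and components: "\<And>K L. (K, L) \<in> C \<Longrightarrow> K \<noteq> {} \<Longrightarrow> L \<noteq> {} \<Longrightarrow> K \<in> S \<and> L \<in> S"
    and joins: "\<And>K L a b. (K, L) \<in> C \<Longrightarrow> a \<in> K \<Longrightarrow> b \<in> L \<Longrightarrow> {a, b} \<in> edges G"
    and covered: "\<And>a b. {a, b} \<in> edges G \<Longrightarrow>
      \<exists>K L. (K, L) \<in> C \<and> (a \<in> K \<and> b \<in> L \<or> a \<in> L \<and> b \<in> K)"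
  shows "st_plus G \<le> card S"
proof -
  let ?C = "{(K, L) \<in> C. K \<noteq> {} \<and> L \<noteq> {}}"
  have "edges G \<subseteq> (\<Union>(K, L) \<in> ?C. {{i, j} | i j. i \<in> K \<and> j \<in> L})"
  proof
    fix e assume e: "e \<in> edges G"
    then obtain a b where ab: "e = {a, b}"
      using G unfolding graph_def by blast
    then obtain K L where KL: "(K, L) \<in> C" "a \<in> K \<and> b \<in> L \<or> a \<in> L \<and> b \<in> K"
      using covered e by blast
    then have "(K, L) \<in> ?C" by auto
    moreover have "e \<in> {{i, j} | i j. i \<in> K \<and> j \<in> L}"
      using KL(2) ab by (auto simp: insert_commute)
    ultimately show "e \<in> (\<Union>(K, L) \<in> ?C. {{i, j} | i j. i \<in> K \<and> j \<in> L})"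
      by blast
  qed
  moreover have "(\<Union>(K, L) \<in> ?C. {{i, j} | i j. i \<in> K \<and> j \<in> L}) \<subseteq> edges G"
    using joins by auto
  moreover have "\<forall>(K, L) \<in> ?C. K \<noteq> {} \<and> L \<noteq> {} \<and> K \<subseteq> verts G \<and> L \<subseteq> verts G"
    using joins graph_edgeD[OF G] by fast
  ultimately have "set_join_cover G ?C"
    unfolding set_join_cover_def set_join_def lgraph.simps by blast
  then have "st_plus G \<le> card (components ?C)"
    unfolding st_plus_def by (intro Least_le) blast
  also have "components ?C \<subseteq> S"
    unfolding components_def using components by fastforce
  then have "card (components ?C) \<le> card S"
    by (rule card_mono[OF S])
  finally show ?thesis .
qed

lemma doubleton_covered:
  assumes "{a, b} = {c, d}" and "(K, L) \<in> C" "c \<in> K" "d \<in> L"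
  shows "\<exists>K L. (K, L) \<in> C \<and> (a \<in> K \<and> b \<in> L \<or> a \<in> L \<and> b \<in> K)"
  using assms by (auto simp: doubleton_eq_iff)

section \<open>Star structure of covers in the family\<close>

lemma calG_common_nbhd_unique:
  assumes "G \<in> calG" "a \<noteq> b"
    and "{a, c} \<in> edges G" "{a, d} \<in> edges G" "{b, c} \<in> edges G" "{b, d} \<in> edges G"
  shows "c = d"
proof -
  have G: "graph G" using assms(1) unfolding calG_def by blast
  show ?thesis
    using assms graph_edgeD[OF G assms(3)] graph_edgeD[OF G assms(6)]
    unfolding calG_def by auto
qed

text \<open>Two elements of \<open>K\<close> have every vertex of \<open>L\<close> and of
  \<open>M\<close> as a common neighbour, and there is only one such vertex. With
  \<open>M = L\<close> this says that the join is a star; with \<open>M\<close> arbitrary, that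
  \<open>K\<close> has a single partner.\<close>

lemma calG_unique_partner:
  assumes "G \<in> calG" "sym_cover G C" "(K, L) \<in> C" "(K, M) \<in> C"
    and "a \<in> K" "K \<noteq> {a}" "w \<in> M"
  shows "L = {w}"
proof -
  obtain b where b: "b \<in> K" "a \<noteq> b" using assms(5,6) by blast
  have "y = w" if "y \<in> L" for y
    using calG_common_nbhd_unique[OF assms(1) b(2)] sym_coverD(4)[OF assms(2)]
      assms(3-5,7) b(1) that by metis
  moreover have "L \<noteq> {}"
    using assms(2,3) sym_coverD(1,3) by metis
  ultimately show ?thesis by blast
qed

section \<open>The path through \<open>x1\<close> and \<open>x2\<close> and its contraction\<close>

text \<open>The degree conditions enter as exact neighbourhoods, and membership in the family as
  nonadjacency of \<open>u\<close> and \<open>v\<close>; for \<open>u = v\<close> the latter says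
  that \<open>u\<close> has no loop. These assumptions are invariant under reversing the path, so
  each one-sided result below also yields its mirror image.\<close>

locale double_subdivision =
  fixes G :: "'a lgraph" and u v x1 x2 :: 'a
  assumes graph: "graph G"
    and uv: "u \<in> verts G" "v \<in> verts G" "{u, v} \<notin> edges G"
    and x: "x1 \<in> verts G" "x2 \<in> verts G" "x1 \<noteq> x2" "x1 \<noteq> u" "x1 \<noteq> v" "x2 \<noteq> u" "x2 \<noteq> v"
    and x1_edge: "{x1, w} \<in> edges G \<longleftrightarrow> w = u \<or> w = x2"
    and x2_edge: "{x2, w} \<in> edges G \<longleftrightarrow> w = v \<or> w = x1"
begin

definition contraction :: "'a lgraph" where
  "contraction = add_edge (remove_verts G {x1, x2}) u v"

lemma swapped: "double_subdivision G v u x2 x1"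
  using graph uv x x1_edge x2_edge by unfold_locales (auto simp: insert_commute)

lemma contraction_swapped: "double_subdivision.contraction G v u x2 x1 = contraction"
  unfolding double_subdivision.contraction_def[OF swapped] contraction_def
  by (simp add: insert_commute add_edge_def)

lemma edge_contraction_iff:
  "{a, b} \<in> edges contraction \<longleftrightarrow>
     a = u \<and> b = v \<or> a = v \<and> b = u \<or>
     {a, b} \<in> edges G \<and> a \<noteq> x1 \<and> a \<noteq> x2 \<and> b \<noteq> x1 \<and> b \<noteq> x2"
  unfolding contraction_def add_edge_def remove_verts_def
  by (auto simp: doubleton_eq_iff)

lemma verts_contraction: "verts contraction = verts G - {x1, x2}"
  unfolding contraction_def add_edge_def remove_verts_def by simp

lemma graph_contraction: "graph contraction"
proof -
  have "\<exists>a \<in> verts contraction. \<exists>b \<in> verts contraction. e = {a, b}"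
    if e: "e \<in> edges contraction" for e
  proof -
    have "e = {u, v} \<or> e \<in> edges G \<and> e \<inter> {x1, x2} = {}"
      using e unfolding contraction_def add_edge_def remove_verts_def by auto
    then show ?thesis
    proof
      assume "e = {u, v}"
      then show ?thesis using uv x unfolding verts_contraction by auto
    next
      assume *: "e \<in> edges G \<and> e \<inter> {x1, x2} = {}"
      then obtain a b where "a \<in> verts G" "b \<in> verts G" "e = {a, b}"
        using graph unfolding graph_def by metis
      then show ?thesis using * unfolding verts_contraction by auto
    qed
  qed
  moreover have "finite (verts contraction)"
    using graph unfolding graph_def verts_contraction by simp
  ultimately show ?thesis unfolding graph_def by blast
qed

lemma edge_at_x:
  assumes e: "{a, b} \<in> edges G" and "{a, b} \<inter> {x1, x2} \<noteq> {}"
  obtains "{a, b} = {x1, u}" | "{a, b} = {x1, x2}" | "{a, b} = {x2, v}"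
proof -
  have e': "{b, a} \<in> edges G" using e by (simp add: insert_commute)
  have "a = x1 \<or> a = x2 \<or> b = x1 \<or> b = x2" using assms(2) by blast
  then have "{a, b} = {x1, u} \<or> {a, b} = {x1, x2} \<or> {a, b} = {x2, v}"
    using e e' x1_edge x2_edge by (elim disjE) (auto simp: doubleton_eq_iff)
  then show ?thesis using that by blast
qed

section \<open>Lower bound: removing two components from a cover of \<open>G\<close>\<close>

text \<open>Consider a pair covering the edge from \<open>x1\<close> to \<open>u\<close>. The side
  of \<open>u\<close> lies in the neighbourhood of \<open>x1\<close>. If it contains
  \<open>x2\<close>, the other side consists of common neighbours of \<open>u\<close> and
  \<open>x2\<close>, and \<open>x1\<close> is the only one because \<open>v\<close> is not adjacent
  to \<open>u\<close>.\<close>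

lemma component_u:
  assumes C: "sym_cover G C"
  shows "({x1}, {u, x2}) \<in> C \<or> {u} \<in> Domain C"
proof -
  have "{x1, u} \<in> edges G" using x1_edge by blast
  then obtain K L where KL: "(K, L) \<in> C" "x1 \<in> K" "u \<in> L"
    using sym_coverD(5)[OF C] by blast
  have edge: "{a, b} \<in> edges G" if "a \<in> K" "b \<in> L" for a b
    using sym_coverD(4)[OF C KL(1)] that .
  have L: "L \<subseteq> {u, x2}" using edge KL x1_edge by blast
  show ?thesis
  proof (cases "x2 \<in> L")
    case True
    have "a = x1" if "a \<in> K" for a
      using edge[OF that True] edge[OF that KL(3)] x2_edge uv(3)
      by (metis insert_commute)
    then have "K = {x1}" using KL by blast
    moreover have "L = {u, x2}" using True KL L by blast
    ultimately show ?thesis using KL by blast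
  next
    case False
    then have "L = {u}" using L KL by blast
    then show ?thesis using KL sym_coverD(1)[OF C] by blast
  qed
qed

text \<open>A pair covering the edge from \<open>x1\<close> to \<open>x2\<close> has sides within
  \<open>{v, x1}\<close> and \<open>{u, x2}\<close>, and \<open>u\<close> and \<open>v\<close>
  cannot both occur. This leaves three shapes, two of which are ruled out by assumption.\<close>

lemma components_x:
  assumes C: "sym_cover G C"
    and "({x1}, {u, x2}) \<notin> C" "({x2}, {v, x1}) \<notin> C"
  shows "{x1} \<in> Domain C \<and> {x2} \<in> Domain C"
proof -
  have "{x1, x2} \<in> edges G" using x1_edge by blast
  then obtain K L where KL: "(K, L) \<in> C" "x1 \<in> K" "x2 \<in> L"
    using sym_coverD(5)[OF C] by blast
  have LK: "(L, K) \<in> C" using sym_coverD(1)[OF C KL(1)] .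
  have edge: "{a, b} \<in> edges G" if "a \<in> K" "b \<in> L" for a b
    using sym_coverD(4)[OF C KL(1)] that .
  have L: "L \<subseteq> {u, x2}" using edge KL x1_edge by blast
  have K: "K \<subseteq> {v, x1}" using edge KL x2_edge by (metis insert_commute insert_iff subsetI)
  have "\<not> (u \<in> L \<and> v \<in> K)" using edge uv(3) by (metis insert_commute)
  then have "K = {x1} \<and> L = {x2} \<or> K = {x1} \<and> L = {u, x2} \<or> K = {v, x1} \<and> L = {x2}"
    using K L KL by blast
  then show ?thesis using KL LK assms by blast
qed

text \<open>After deletion \<open>p\<close> vanishes and \<open>q\<close> vanishes or duplicates
  another image, so two components are saved. The new edge is covered by \<open>{u}\<close> and
  \<open>{v}\<close> at no cost, since both already occur as images.\<close>

lemma st_plus_contraction_delete: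
  fixes C :: "('a set \<times> 'a set) set"
  defines "f \<equiv> \<lambda>K. K - {x1, x2}"
  assumes C: "sym_cover G C"
    and "{u} \<in> f ` Domain C" "{v} \<in> f ` Domain C"
    and pq: "p \<in> Domain C" "q \<in> Domain C" "p \<noteq> q"
    and p: "f p = {}" and q: "f q = {} \<or> f q \<in> f ` (Domain C - {p, q})"
  shows "st_plus contraction + 2 \<le> card (Domain C)"
proof -
  let ?S = "f ` Domain C - {{}}"
  let ?D = "insert ({u}, {v}) {(f K, f L) | K L. (K, L) \<in> C}"
  have fin: "finite (Domain C)" using sym_coverD(2)[OF C] .
  have range: "L \<in> Domain C" if "(K, L) \<in> C" for K L
    using sym_coverD(1)[OF C that] by blast
  have "st_plus contraction \<le> card ?S"
  proof (rule st_plus_le_card[OF graph_contraction, where C = ?D])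
    show "finite ?S" using fin by blast
    show "K \<in> ?S \<and> L \<in> ?S" if "(K, L) \<in> ?D" "K \<noteq> {}" "L \<noteq> {}" for K L
      using that assms(3,4) range by auto
    show "{a, b} \<in> edges contraction" if "(K, L) \<in> ?D" "a \<in> K" "b \<in> L" for K L a b
      using that sym_coverD(4)[OF C] unfolding edge_contraction_iff f_def by auto
    show "\<exists>K L. (K, L) \<in> ?D \<and> (a \<in> K \<and> b \<in> L \<or> a \<in> L \<and> b \<in> K)"
      if ab: "{a, b} \<in> edges contraction" for a b
    proof (cases "a = u \<and> b = v \<or> a = v \<and> b = u")
      case False
      then have *: "{a, b} \<in> edges G" "a \<notin> {x1, x2}" "b \<notin> {x1, x2}"
        using ab edge_contraction_iff by auto
      then obtain K L where "(K, L) \<in> C" "a \<in> K" "b \<in> L"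
        using sym_coverD(5)[OF C] by blast
      then have "(f K, f L) \<in> ?D" "a \<in> f K" "b \<in> f L"
        using * unfolding f_def by auto
      then show ?thesis by blast
    qed blast
  qed
  also have "?S \<subseteq> f ` (Domain C - {p, q})"
    using p q by auto
  then have "card ?S \<le> card (Domain C - {p, q})"
    by (rule surj_card_le[OF finite_Diff[OF fin]])
  also have "\<dots> + 2 = card (Domain C)"
    using pq fin card_mono[of "Domain C" "{p, q}"] by (subst card_Diff_subset) auto
  finally show ?thesis by simp
qed

text \<open>Without \<open>{u}\<close> and \<open>{x2}\<close>, the vertex \<open>x1\<close> occurs
  only in the components of the pair \<open>({x1}, {u, x2})\<close> or opposite \<open>x1\<close>
  nothing else is possible, so dropping these two components loses only edges at \<open>x1\<close>.
  The edge from \<open>x2\<close> to \<open>v\<close> is covered elsewhere, and replacing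
  \<open>x2\<close> by \<open>u\<close> turns it into the new edge.\<close>

lemma st_plus_contraction_replace:
  assumes C: "sym_cover G C"
    and P: "({x1}, {u, x2}) \<in> C" and no_u: "{u} \<notin> Domain C" and no_x2: "{x2} \<notin> Domain C"
  shows "st_plus contraction + 2 \<le> card (Domain C)"
proof -
  define g where "g = (\<lambda>K. if x2 \<in> K then insert u (K - {x2}) else K)"
  let ?A = "Domain C - {{x1}, {u, x2}}"
  let ?D = "{(g K, g L) | K L. (K, L) \<in> C \<and> K \<in> ?A \<and> L \<in> ?A}"
  note symC = sym_coverD(1)[OF C] and edge = sym_coverD(4)[OF C]
  have fin: "finite (Domain C)" using sym_coverD(2)[OF C] .
  have x1_partner: "K = {x1} \<and> L = {u, x2}" if "(K, L) \<in> C" "x1 \<in> K" for K L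
  proof -
    have L: "L \<subseteq> {u, x2}" using edge[OF that] x1_edge by blast
    moreover have "L \<noteq> {}" "L \<noteq> {u}" "L \<noteq> {x2}"
      using symC[OF that(1)] no_u no_x2 sym_coverD(3)[OF C] by auto
    ultimately have L': "L = {u, x2}" by blast
    have "a = x1" if "a \<in> K" for a
      using edge[OF \<open>(K, L) \<in> C\<close> that] L' x2_edge uv(3) by (metis insert_commute insert_iff)
    then show ?thesis using L' that by blast
  qed
  have x2_partner: "L = {v}" if "(K, L) \<in> C" "x2 \<in> K" "L \<noteq> {x1}" for K L
  proof -
    have "L \<subseteq> {v, x1}" using edge[OF that(1,2)] x2_edge by blast
    moreover have "x1 \<notin> L" using x1_partner[OF symC[OF that(1)]] that(3) by blast
    moreover have "L \<noteq> {}" using symC[OF that(1)] sym_coverD(3)[OF C] by blast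
    ultimately show ?thesis by blast
  qed
  have ux2_partner: "L = {x1}" if "(K, L) \<in> C" "K = {u, x2}" for K L
    using edge[of K L u] x2_partner[OF that(1)] that uv(3) by blast
  \<comment> \<open>Among the surviving pairs \<open>x2\<close> occurs on at most one side, because
    its partner is \<open>{v}\<close>. The case \<open>x2 \<notin> L\<close> therefore suffices, up
    to exchanging the sides.\<close>
  have join: "{a, b} \<in> edges contraction"
    if KL: "(K, L) \<in> C" "K \<in> ?A" "L \<in> ?A" and ab: "a \<in> g K" "b \<in> g L" and x2: "x2 \<notin> L"
    for K L a b
  proof -
    have b: "b \<in> L" using ab x2 unfolding g_def by simp
    have "x1 \<notin> K" "x1 \<notin> L" using x1_partner[OF KL(1)] x1_partner[OF symC[OF KL(1)]] KL by blast+
    show ?thesis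
    proof (cases "x2 \<in> K")
      case True
      then have "L = {v}" using x2_partner[OF KL(1)] KL by blast
      then show ?thesis
        using ab(1) b True \<open>x1 \<notin> K\<close> edge[OF KL(1), of a b] x
        unfolding g_def edge_contraction_iff by auto
    next
      case False
      then have "a \<in> K" using ab unfolding g_def by simp
      then show ?thesis
        using b False x2 \<open>x1 \<notin> K\<close> \<open>x1 \<notin> L\<close> edge[OF KL(1), of a b]
        unfolding edge_contraction_iff by blast
    qed
  qed
  have "st_plus contraction \<le> card (g ` ?A)"
  proof (rule st_plus_le_card[OF graph_contraction, where C = ?D])
    show "finite (g ` ?A)" using fin by blast
    show "K \<in> g ` ?A \<and> L \<in> g ` ?A" if "(K, L) \<in> ?D" for K L
      using that by blast
    show "{a, b} \<in> edges contraction" if "(K, L) \<in> ?D" "a \<in> K" "b \<in> L" for K L a b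
    proof -
      obtain K' L' where *: "(K', L') \<in> C" "K' \<in> ?A" "L' \<in> ?A" "K = g K'" "L = g L'"
        using \<open>(K, L) \<in> ?D\<close> by blast
      show ?thesis
      proof (cases "x2 \<in> L'")
        case True
        then have "K' = {v}" using x2_partner[OF symC[OF *(1)]] * by blast
        then have "x2 \<notin> K'" using x by blast
        then have "{b, a} \<in> edges contraction"
          using join[OF symC[OF *(1)] *(3,2)] *(4,5) that(2,3) by simp
        then show ?thesis by (simp add: insert_commute)
      next
        case False
        then show ?thesis using join[OF *(1-3)] *(4,5) that(2,3) by simp
      qed
    qed
    \<comment> \<open>Here \<open>a'\<close> is the endpoint before the replacement:
      \<open>a' = x2\<close>, \<open>b = v\<close> produces the new edge, and \<open>a' = a\<close>
      handles the old ones.\<close>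
    have covered: "\<exists>K L. (K, L) \<in> ?D \<and> a \<in> K \<and> b \<in> L"
      if e: "{a', b} \<in> edges G" and ne: "a' \<noteq> x1" "b \<noteq> x1" "b \<noteq> x2"
        and a: "a = (if a' = x2 then u else a')"
      for a a' b
    proof -
      obtain K L where KL: "(K, L) \<in> C" "a' \<in> K" "b \<in> L"
        using sym_coverD(5)[OF C e] by blast
      then have "K \<noteq> {x1}" "L \<noteq> {x1}" using ne by auto
      then have "K \<in> ?A" "L \<in> ?A"
        using KL(1) symC[OF KL(1)] ux2_partner by blast+
      moreover have "a \<in> g K" "b \<in> g L" using a ne KL unfolding g_def by auto
      ultimately show ?thesis using KL by blast
    qed
    show "\<exists>K L. (K, L) \<in> ?D \<and> (a \<in> K \<and> b \<in> L \<or> a \<in> L \<and> b \<in> K)"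
      if ab: "{a, b} \<in> edges contraction" for a b
    proof -
      have "\<exists>K L. (K, L) \<in> ?D \<and> u \<in> K \<and> v \<in> L"
        using covered[of x2 v] x2_edge x by auto
      then obtain K L where uv_pair: "(K, L) \<in> ?D" "u \<in> K" "v \<in> L"
        by (elim exE conjE)
      consider "a = u" "b = v" | "a = v" "b = u"
        | "{a, b} \<in> edges G" "a \<noteq> x1" "a \<noteq> x2" "b \<noteq> x1" "b \<noteq> x2"
        using ab unfolding edge_contraction_iff by blast
      then show ?thesis
      proof cases
        case 3
        then have "\<exists>K L. (K, L) \<in> ?D \<and> a \<in> K \<and> b \<in> L"
          by (intro covered) auto
        then show ?thesis by meson
      qed (intro exI[of _ K] exI[of _ L], use uv_pair in simp)+
    qed
  qed
  also have "\<dots> \<le> card ?A" using fin by (simp add: card_image_le)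
  also have "\<dots> + 2 = card (Domain C)"
  proof -
    have "{{x1}, {u, x2}} \<subseteq> Domain C" using P symC by blast
    moreover have "{x1} \<noteq> {u, x2}" using x by blast
    ultimately show ?thesis
      using fin card_mono[of "Domain C" "{{x1}, {u, x2}}"] by (subst card_Diff_subset) auto
  qed
  finally show ?thesis by simp
qed

text \<open>If \<open>{x2}\<close> is a component, deletion empties both \<open>{x1}\<close> and
  \<open>{x2}\<close>. If instead \<open>{u}\<close> is one, deletion empties \<open>{x1}\<close>
  and merges \<open>{u, x2}\<close> with \<open>{u}\<close>. If neither is, replacement
  applies.\<close>

lemma st_plus_contraction_one_sided:
  assumes C: "sym_cover G C"
    and P: "({x1}, {u, x2}) \<in> C" and Q: "{v} \<in> Domain C"
  shows "st_plus contraction + 2 \<le> card (Domain C)"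
proof (cases "{u} \<in> Domain C \<or> {x2} \<in> Domain C")
  case True
  have dom: "{x1} \<in> Domain C" "{u, x2} \<in> Domain C"
    using P sym_coverD(1)[OF C P] by blast+
  have u: "{u} = {u, x2} - {x1, x2}" and v: "{v} = {v} - {x1, x2}" using x by auto
  have uv_image: "{u} \<in> (\<lambda>K. K - {x1, x2}) ` Domain C" "{v} \<in> (\<lambda>K. K - {x1, x2}) ` Domain C"
    using dom u Q v by blast+
  show ?thesis
  proof (cases "{x2} \<in> Domain C")
    case True
    then show ?thesis
      using st_plus_contraction_delete[OF C uv_image, of "{x1}" "{x2}"] dom x by simp
  next
    case False
    then have "{u} \<in> Domain C - {{x1}, {u, x2}}" using True x by auto
    moreover have "{u, x2} - {x1, x2} = {u} - {x1, x2}" by blast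
    ultimately have "{u, x2} - {x1, x2} \<in> (\<lambda>K. K - {x1, x2}) ` (Domain C - {{x1}, {u, x2}})"
      by blast
    then show ?thesis
      using st_plus_contraction_delete[OF C uv_image, of "{x1}" "{u, x2}"] dom x by auto
  qed
next
  case False
  then show ?thesis using st_plus_contraction_replace[OF C P] by blast
qed

lemma st_plus_contraction_le: "st_plus contraction + 2 \<le> st_plus G"
proof -
  obtain C where C: "sym_cover G C" and card: "card (Domain C) = st_plus G"
    by (rule sym_cover_attained[OF graph])
  interpret swapped: double_subdivision G v u x2 x1 by (rule swapped)
  let ?P = "({x1}, {u, x2}) \<in> C" and ?Q = "({x2}, {v, x1}) \<in> C"
  have "st_plus contraction + 2 \<le> card (Domain C)"
  \<comment> \<open>If both pairs occur, or neither, then \<open>{x1}\<close> and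
    \<open>{x2}\<close> are components and deletion empties both. If exactly one occurs,
    \<open>component_u\<close> or its mirror image supplies the singleton at the opposite end that
    the one-sided bound requires.\<close>
  proof (cases "?P \<longleftrightarrow> ?Q")
    case True
    have x_dom: "{x1} \<in> Domain C" "{x2} \<in> Domain C"
      using True components_x[OF C] by auto
    have u: "{u} = {u, x2} - {x1, x2}" "{u} = {u} - {x1, x2}"
      and v: "{v} = {v, x1} - {x1, x2}" "{v} = {v} - {x1, x2}"
      using x by auto
    have "{u, x2} \<in> Domain C \<or> {u} \<in> Domain C"
      using component_u[OF C] sym_coverD(1)[OF C] by blast
    then have u': "{u} \<in> (\<lambda>K. K - {x1, x2}) ` Domain C" using u by blast
    have "{v, x1} \<in> Domain C \<or> {v} \<in> Domain C"
      using swapped.component_u[OF C] sym_coverD(1)[OF C] by blast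
    then have v': "{v} \<in> (\<lambda>K. K - {x1, x2}) ` Domain C" using v by blast
    show ?thesis
      using st_plus_contraction_delete[OF C u' v' x_dom] x by simp
  next
    case False
    then show ?thesis
      using st_plus_contraction_one_sided[OF C] swapped.component_u[OF C]
        swapped.st_plus_contraction_one_sided[OF C] component_u[OF C]
      unfolding contraction_swapped by blast
  qed
  then show ?thesis using card by simp
qed

section \<open>Upper bound: lifting a cover of the contraction\<close>

text \<open>The edge from \<open>u\<close> to \<open>v\<close> is absent from \<open>G\<close>, so
  \<open>h\<close> trades it for an edge of \<open>G\<close>: opposite the centre \<open>{v}\<close>
  the leaf \<open>u\<close> becomes \<open>x2\<close>, and opposite \<open>{u}\<close> the leaf
  \<open>v\<close> becomes \<open>x1\<close>. A component with several elements has only one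
  partner, so no other join is disturbed. The pairs of \<open>{u}\<close> with \<open>{v}\<close>
  cover nothing but the new edge and are left out.\<close>

lemma contraction_cover_lift:
  assumes H: "contraction \<in> calG" and C: "sym_cover contraction C"
  obtains h where "\<And>w. h {w} = {w}"
    and "\<And>K L a b. (K, L) \<in> C - {({u}, {v}), ({v}, {u})} \<Longrightarrow>
      a \<in> h K \<Longrightarrow> b \<in> h L \<Longrightarrow> {a, b} \<in> edges G"
    and "\<And>a b. {a, b} \<in> edges G \<Longrightarrow> {a, b} \<inter> {x1, x2} = {} \<Longrightarrow>
      \<exists>K L. (K, L) \<in> C - {({u}, {v}), ({v}, {u})} \<and> a \<in> h K \<and> b \<in> h L"
    and "\<And>K. (K, {v}) \<in> C \<Longrightarrow> u \<in> K \<Longrightarrow> K \<noteq> {u} \<Longrightarrow> x2 \<in> h K"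
proof -
  define h where "h = (\<lambda>K.
    if u \<in> K \<and> K \<noteq> {u} \<and> (K, {v}) \<in> C then insert x2 (K - {u})
    else if v \<in> K \<and> K \<noteq> {v} \<and> (K, {u}) \<in> C then insert x1 (K - {v})
    else K)"
  let ?bad = "{({u}, {v}), ({v}, {u})}"
  note symC = sym_coverD(1)[OF C] and edge = sym_coverD(4)[OF C]
    and partner = calG_unique_partner[OF H C]
  have single: "h {w} = {w}" for w unfolding h_def by auto
  have h_cases: "h K = K \<or>
      u \<in> K \<and> K \<noteq> {u} \<and> L = {v} \<and> h K = insert x2 (K - {u}) \<or>
      v \<in> K \<and> K \<noteq> {v} \<and> L = {u} \<and> h K = insert x1 (K - {v})" if "(K, L) \<in> C" for K L
  proof -
    have "L = {v}" if "u \<in> K" "K \<noteq> {u}" "(K, {v}) \<in> C"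
      using partner[OF \<open>(K, L) \<in> C\<close> that(3,1,2)] by simp
    moreover have "L = {u}" if "v \<in> K" "K \<noteq> {v}" "(K, {u}) \<in> C"
      using partner[OF \<open>(K, L) \<in> C\<close> that(3,1,2)] by simp
    ultimately show ?thesis unfolding h_def by auto
  qed
  have not_x: "x1 \<notin> K" "x2 \<notin> K" if "(K, L) \<in> C" for K L
    using that edge[OF that] sym_coverD(3)[OF C symC[OF that]] x
    unfolding edge_contraction_iff by blast+
  \<comment> \<open>A component altered by \<open>h\<close> has a singleton as partner, and
    singletons are fixed. Hence at most one side changes, and by symmetry it may be taken to be
    \<open>K\<close>.\<close>
  have join: "{a, b} \<in> edges G" if KL: "(K, L) \<in> C" "(K, L) \<notin> ?bad" and ab: "a \<in> h K" "b \<in> h L"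
    and hL: "h L = L" for K L a b
  proof -
    have e: "{a', b} \<in> edges contraction" if "a' \<in> K" for a'
      using edge[OF KL(1) that] ab hL by blast
    consider "h K = K" | "L = {v}" "h K = insert x2 (K - {u})" | "L = {u}" "h K = insert x1 (K - {v})"
      using h_cases[OF KL(1)] by blast
    then show ?thesis
    proof cases
      case 1
      then have aK: "a \<in> K" and bL: "b \<in> L" using ab hL by auto
      have star: "K = {a} \<or> L = {b}"
        using partner[OF KL(1) KL(1) aK _ bL] by blast
      have False if "a = u" "b = v"
      proof (cases "L = {v}")
        case True
        then have "h K = insert x2 (K - {u})" unfolding h_def using that aK KL by auto
        then show False using 1 not_x[OF KL(1)] by blast
      next
        case False
        then have "K = {u}" using star that by blast
        then have "h L \<noteq> L"
          using False symC[OF KL(1)] that bL not_x[OF symC[OF KL(1)]] unfolding h_def by auto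
        then show False using hL by blast
      qed
      moreover have False if "a = v" "b = u" "u \<noteq> v"
      proof (cases "L = {u}")
        case True
        then have "h K \<noteq> K" unfolding h_def using that aK KL not_x[OF KL(1)] by auto
        then show False using 1 by blast
      next
        case False
        then have "K = {v}" using star that by blast
        then have "h L \<noteq> L"
          using False symC[OF KL(1)] that bL not_x[OF symC[OF KL(1)]] unfolding h_def by auto
        then show False using hL by blast
      qed
      ultimately show ?thesis using e[OF aK] unfolding edge_contraction_iff by blast
    next
      case 2
      then have "b = v" using ab hL by blast
      then show ?thesis
        using ab(1) 2 e[of a] x2_edge[of v] unfolding edge_contraction_iff by auto
    next
      case 3
      then have "b = u" using ab hL by blast
      then show ?thesis
        using ab(1) 3 e[of a] x1_edge[of u] unfolding edge_contraction_iff by auto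
    qed
  qed
  show ?thesis
  proof
    show "h {w} = {w}" for w by (rule single)
    show "{a, b} \<in> edges G" if KL: "(K, L) \<in> C - ?bad" and ab: "a \<in> h K" "b \<in> h L" for K L a b
    proof (cases "h L = L")
      case True
      then show ?thesis using join KL ab by blast
    next
      case False
      then have "h K = K" using h_cases[OF symC] KL single by blast
      then have "{b, a} \<in> edges G" using join[OF symC] KL ab by blast
      then show ?thesis by (simp add: insert_commute)
    qed
    show "\<exists>K L. (K, L) \<in> C - ?bad \<and> a \<in> h K \<and> b \<in> h L"
      if e: "{a, b} \<in> edges G" and disj: "{a, b} \<inter> {x1, x2} = {}" for a b
    proof -
      have ne: "\<not> (a = u \<and> b = v)" "\<not> (a = v \<and> b = u)"
        using e uv(3) by (auto simp: insert_commute)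
      have "{a, b} \<in> edges contraction"
        using e disj unfolding edge_contraction_iff by blast
      then obtain K L where KL: "(K, L) \<in> C" "a \<in> K" "b \<in> L"
        using sym_coverD(5)[OF C] by blast
      \<comment> \<open>\<open>h\<close> removes \<open>u\<close> only opposite \<open>{v}\<close>
        and \<open>v\<close> only opposite \<open>{u}\<close>, so an endpoint could be lost only if
        the edge joined \<open>u\<close> to \<open>v\<close>.\<close>
      have "a \<in> h K" using h_cases[OF KL(1)] KL ne by auto
      moreover have "b \<in> h L" using h_cases[OF symC[OF KL(1)]] KL ne by auto
      moreover have "(K, L) \<notin> ?bad" using KL ne by auto
      ultimately show ?thesis using KL by blast
    qed
    show "x2 \<in> h K" if "(K, {v}) \<in> C" "u \<in> K" "K \<noteq> {u}" for K
      using that unfolding h_def by simp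
  qed
qed

text \<open>As \<open>h\<close> fixes singletons, \<open>{u}\<close> and \<open>{v}\<close> remain
  available. Joining \<open>{x1}\<close> to \<open>{u}\<close>, \<open>{x1}\<close> to
  \<open>{x2}\<close> and \<open>{x2}\<close> to \<open>{v}\<close> then restores the path with only
  \<open>{x1}\<close> and \<open>{x2}\<close> as new components.\<close>

lemma st_plus_le_singletons:
  assumes H: "contraction \<in> calG" and C: "sym_cover contraction C"
    and u: "{u} \<in> Domain C" and v: "{v} \<in> Domain C"
  shows "st_plus G \<le> card (Domain C) + 2"
proof -
  obtain h where single: "\<And>w. h {w} = {w}"
    and join: "\<And>K L a b. (K, L) \<in> C - {({u}, {v}), ({v}, {u})} \<Longrightarrow>
      a \<in> h K \<Longrightarrow> b \<in> h L \<Longrightarrow> {a, b} \<in> edges G"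
    and covered: "\<And>a b. {a, b} \<in> edges G \<Longrightarrow> {a, b} \<inter> {x1, x2} = {} \<Longrightarrow>
      \<exists>K L. (K, L) \<in> C - {({u}, {v}), ({v}, {u})} \<and> a \<in> h K \<and> b \<in> h L"
    by (rule contraction_cover_lift[OF H C]) blast
  let ?bad = "{({u}, {v}), ({v}, {u})}"
  let ?D = "insert ({x1}, {u}) (insert ({x1}, {x2}) (insert ({x2}, {v})
    {(h K, h L) | K L. (K, L) \<in> C - ?bad}))"
  let ?S = "h ` Domain C \<union> {{x1}, {x2}}"
  have fin: "finite (Domain C)" using sym_coverD(2)[OF C] .
  have "st_plus G \<le> card ?S"
  proof (rule st_plus_le_card[OF graph, where C = ?D])
    show "finite ?S" using fin by blast
    have uv_image: "{u} \<in> h ` Domain C" "{v} \<in> h ` Domain C"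
      using single u v by (metis image_eqI)+
    have D_cases: "(\<exists>K' L'. (K', L') \<in> C - ?bad \<and> K = h K' \<and> L = h L') \<or>
        K = {x1} \<and> L = {u} \<or> K = {x1} \<and> L = {x2} \<or> K = {x2} \<and> L = {v}"
      if "(K, L) \<in> ?D" for K L
      using that by (elim insertE CollectE exE conjE, simp, simp, simp, metis Pair_inject)
    show "K \<in> ?S \<and> L \<in> ?S" if "(K, L) \<in> ?D" for K L
      using D_cases[OF that] uv_image sym_coverD(1)[OF C] by (elim disjE exE conjE) blast+
    show "{a, b} \<in> edges G" if "(K, L) \<in> ?D" "a \<in> K" "b \<in> L" for K L a b
      using D_cases[OF that(1)] that(2,3) join x1_edge x2_edge by (elim disjE exE conjE) simp_all
    show "\<exists>K L. (K, L) \<in> ?D \<and> (a \<in> K \<and> b \<in> L \<or> a \<in> L \<and> b \<in> K)"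
      if e: "{a, b} \<in> edges G" for a b
    proof (cases "{a, b} \<inter> {x1, x2} = {}")
      case True
      obtain K L where KL: "(K, L) \<in> C - ?bad" "a \<in> h K" "b \<in> h L"
        using covered[OF e True] by (elim exE conjE)
      then have "(h K, h L) \<in> ?D" by blast
      then show ?thesis by (rule doubleton_covered[OF refl _ KL(2,3)])
    next
      case False
      from edge_at_x[OF e False] show ?thesis
      proof cases
        case 1
        show ?thesis by (rule doubleton_covered[OF 1, of "{x1}" "{u}"]) simp_all
      next
        case 2
        show ?thesis by (rule doubleton_covered[OF 2, of "{x1}" "{x2}"]) simp_all
      next
        case 3
        show ?thesis by (rule doubleton_covered[OF 3, of "{x2}" "{v}"]) simp_all
      qed
    qed
  qed
  also have "\<dots> \<le> card (h ` Domain C) + card {{x1}, {x2}}" by (rule card_Un_le)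
  also have "\<dots> \<le> card (Domain C) + 2"
    using card_image_le[OF fin] by (intro add_mono) (auto simp: card_insert_if)
  finally show ?thesis .
qed

text \<open>Without \<open>{u}\<close>, the new edge lies in a star centred at \<open>v\<close>
  whose leaf set has several elements. Its lift contains \<open>x2\<close> and so covers the edge
  from \<open>x2\<close> to \<open>v\<close>; the single join of \<open>{x1}\<close> with
  \<open>{u, x2}\<close> supplies the other two edges.\<close>

lemma st_plus_le_no_singleton:
  assumes H: "contraction \<in> calG" and C: "sym_cover contraction C"
    and no_u: "{u} \<notin> Domain C"
  shows "st_plus G \<le> card (Domain C) + 2"
proof -
  obtain h where single: "\<And>w. h {w} = {w}"
    and join: "\<And>K L a b. (K, L) \<in> C - {({u}, {v}), ({v}, {u})} \<Longrightarrow>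
      a \<in> h K \<Longrightarrow> b \<in> h L \<Longrightarrow> {a, b} \<in> edges G"
    and covered: "\<And>a b. {a, b} \<in> edges G \<Longrightarrow> {a, b} \<inter> {x1, x2} = {} \<Longrightarrow>
      \<exists>K L. (K, L) \<in> C - {({u}, {v}), ({v}, {u})} \<and> a \<in> h K \<and> b \<in> h L"
    and x2_in: "\<And>K. (K, {v}) \<in> C \<Longrightarrow> u \<in> K \<Longrightarrow> K \<noteq> {u} \<Longrightarrow> x2 \<in> h K"
    by (rule contraction_cover_lift[OF H C]) blast
  let ?bad = "{({u}, {v}), ({v}, {u})}"
  let ?D = "insert ({x1}, {u, x2}) {(h K, h L) | K L. (K, L) \<in> C - ?bad}"
  let ?S = "h ` Domain C \<union> {{x1}, {u, x2}}"
  have fin: "finite (Domain C)" using sym_coverD(2)[OF C] .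
  have "{u, v} \<in> edges contraction" unfolding edge_contraction_iff by blast
  then obtain K L where KL: "(K, L) \<in> C" "u \<in> K" "v \<in> L"
    using sym_coverD(5)[OF C] by blast
  have K: "K \<noteq> {u}" using KL no_u by blast
  then have L: "L = {v}" using calG_unique_partner[OF H C KL(1) KL(1) KL(2) _ KL(3)] by blast
  have "(K, L) \<in> C - ?bad" using KL K L no_u sym_coverD(1)[OF C KL(1)] by blast
  then have x2v: "\<exists>K L. (K, L) \<in> ?D \<and> x2 \<in> K \<and> v \<in> L"
    using x2_in[of K] KL K L single[of v] by blast
  have "st_plus G \<le> card ?S"
  proof (rule st_plus_le_card[OF graph, where C = ?D])
    show "finite ?S" using fin by blast
    show "K \<in> ?S \<and> L \<in> ?S" if "(K, L) \<in> ?D" for K L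
      using that sym_coverD(1)[OF C] by auto
    show "{a, b} \<in> edges G" if "(K, L) \<in> ?D" "a \<in> K" "b \<in> L" for K L a b
      using that join x1_edge by auto
    show "\<exists>K L. (K, L) \<in> ?D \<and> (a \<in> K \<and> b \<in> L \<or> a \<in> L \<and> b \<in> K)"
      if e: "{a, b} \<in> edges G" for a b
    proof (cases "{a, b} \<inter> {x1, x2} = {}")
      case True
      then show ?thesis using covered[OF e] by blast
    next
      case False
      from edge_at_x[OF e False] show ?thesis
      proof cases
        case 1
        show ?thesis by (rule doubleton_covered[OF 1, of "{x1}" "{u, x2}"]) simp_all
      next
        case 2
        show ?thesis by (rule doubleton_covered[OF 2, of "{x1}" "{u, x2}"]) simp_all
      next
        case 3
        from x2v obtain K L where "(K, L) \<in> ?D" "x2 \<in> K" "v \<in> L"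
          by (elim exE conjE)
        then show ?thesis by (rule doubleton_covered[OF 3])
      qed
    qed
  qed
  also have "\<dots> \<le> card (h ` Domain C) + card {{x1}, {u, x2}}" by (rule card_Un_le)
  also have "\<dots> \<le> card (Domain C) + 2"
    using card_image_le[OF fin] by (intro add_mono) (auto simp: card_insert_if)
  finally show ?thesis .
qed

lemma st_plus_le_contraction:
  assumes H: "contraction \<in> calG"
  shows "st_plus G \<le> st_plus contraction + 2"
proof -
  obtain C where C: "sym_cover contraction C" and card: "card (Domain C) = st_plus contraction"
    by (rule sym_cover_attained[OF graph_contraction])
  interpret swapped: double_subdivision G v u x2 x1 by (rule swapped)
  have "st_plus G \<le> card (Domain C) + 2"
    using st_plus_le_singletons[OF H C] st_plus_le_no_singleton[OF H C]
      swapped.st_plus_le_no_singleton[unfolded contraction_swapped, OF H C] by blast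
  then show ?thesis using card by simp
qed

end

section \<open>From degrees to neighbourhoods, and the comparison of gaps\<close>

text \<open>Two distinct neighbours already account for degree 2, and a loop would raise the degree
  to at least 3.\<close>

lemma nbhd_of_deg_2:
  assumes G: "graph G" and "deg G x = 2" and "{x, a} \<in> edges G" "{x, b} \<in> edges G" "a \<noteq> b"
  shows "nbhd G x = {a, b}"
proof -
  have "nbhd G x \<subseteq> verts G" using graph_edgeD[OF G] unfolding nbhd_def by blast
  then have fin: "finite (nbhd G x)" using G finite_subset unfolding graph_def by blast
  have sub: "{a, b} \<subseteq> nbhd G x" using assms unfolding nbhd_def by blast
  have "card {a, b} = 2" using assms by simp
  then have "card (nbhd G x) = card {a, b}"
    using card_mono[OF fin sub] assms(2) unfolding deg_def by (auto split: if_splits)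
  then show ?thesis using card_subset_eq[OF fin sub] by simp
qed

theorem lemma3p8:
  fixes G G' :: "'a lgraph" and u v x1 x2 :: 'a
  assumes "G \<in> calG"
    and "walk G [u, x1, x2, v]"
    and "u \<in> verts G" and "v \<in> verts G"
    and "x1 \<in> verts G - {u, v}" and "x2 \<in> verts G - {u, v}" and "x1 \<noteq> x2"
    and "deg G x1 = 2" and "deg G x2 = 2"
    and "G' = add_edge (remove_verts G {x1, x2}) u v"
  shows "gap G \<le> gap G' \<and> (G' \<in> calG \<longrightarrow> gap G = gap G')"
proof -
  have G: "graph G" using assms(1) unfolding calG_def by blast
  have e: "{x1, u} \<in> edges G" "{x1, x2} \<in> edges G" "{x2, x1} \<in> edges G" "{x2, v} \<in> edges G"
    using assms(2) unfolding walk_def by (auto simp: insert_commute)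
  have "nbhd G x1 = {u, x2}" "nbhd G x2 = {v, x1}"
    using nbhd_of_deg_2[OF G] e assms(5-9) by auto
  then have n: "{x1, w} \<in> edges G \<longleftrightarrow> w = u \<or> w = x2" "{x2, w} \<in> edges G \<longleftrightarrow> w = v \<or> w = x1" for w
    unfolding nbhd_def by auto
  \<comment> \<open>Otherwise the distinct vertices \<open>u\<close> and \<open>x2\<close> would
    have the two common neighbours \<open>x1\<close> and \<open>v\<close>; this also works for
    \<open>u = v\<close>.\<close>
  have "{u, v} \<notin> edges G"
    using calG_common_nbhd_unique[OF assms(1), of u x2 x1 v] e assms(5,6)
    by (auto simp: insert_commute)
  then interpret double_subdivision G u v x1 x2
    using G n assms(3-7) by unfold_locales simp_all
  have G': "G' = contraction" unfolding contraction_def assms(10) ..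
  \<comment> \<open>The vertex count drops by exactly 2, so the bounds on \<open>st_plus\<close>
    with offset 2 translate directly into the comparison of gaps.\<close>
  have "card (verts G') + 2 = card (verts G)"
  proof -
    have "finite (verts G)" using G unfolding graph_def by blast
    then show ?thesis
      using assms(5-7) card_mono[of "verts G" "{x1, x2}"]
      unfolding G' verts_contraction by (subst card_Diff_subset) auto
  qed
  then show ?thesis
    using st_plus_contraction_le st_plus_le_contraction unfolding gap_def G' by auto
qed

end
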